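(* Let $n\ge4$ and, for $k\in\{1,2,3\}$, let $1\le i_k,j_k,r_k,s_k\le n^2$ be integers with $i_k+j_k\le n^2+1$ and $r_k+s_k\ge n^2+1$, such that $i_3+j_3-1=j_2$, $i_2+j_2-1=j_1$, $r_3+s_3-n^2=s_2$ and $r_2+s_2-n^2=s_1$. Then upper bounds on the eigenvalues of $\mathcal{Q}(n)$ are given by $$\lambda_{i_1+j_1-1}(\mathcal{Q}(n))\le\lambda_{i_1}(G_{1,2})+\lambda_{j_1}(G_3),$$ $$\lambda_{j_1}(G_3)=\lambda_{i_2+j_2-1}(G_3)\le\lambda_{i_2}(G_3^1)+\lambda_{j_2}(G_3^2),$$ $$\lambda_{j_2}(G_3^2)=\lambda_{i_3+j_3-1}(G_3^2)\le\lambda_{i_3}(G_{3,H}^2)+\lambda_{j_3}(G_{3,V}^2),$$ and lower bounds by $$\lambda_{r_1}(G_{1,2})+\lambda_{s_1}(G_3)\le\lambda_{r_1+s_1-n^2}(\mathcal{Q}(n)),$$ $$\lambda_{r_2}(G_3^1)+\lambda_{s_2}(G_3^2)\le\lambda_{r_2+s_2-n^2}(G_3)=\lambda_{s_1}(G_3),$$ $$\lambda_{r_3}(G_{3,H}^2)+\lambda_{s_3}(G_{3,V}^2)\le\lambda_{r_3+s_3-n^2}(G_3^2)=\lambda_{s_2}(G_3^2).$$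
   Context: For a graph $G$ on $n^2$ vertices, $\lambda_1(G)\ge\lambda_2(G)\ge\dots\ge\lambda_{n^2}(G)$ are the eigenvalues of its adjacency matrix in non-increasing order, with multiplicity. The $n$-Queens' graph $\mathcal{Q}(n)$ is the simple graph whose vertices are the $n^2$ squares $(r,c)$, $1\le r,c\le n$, of the $n\times n$ chessboard, two distinct squares being adjacent if and only if they lie in the same row, in the same column, or on a common diagonal (of either direction). All the following graphs have vertex set $V(\mathcal{Q}(n))$. Put $V_1=\{(r,c)\mid c\le r\}$ and $V_2=\{(r,c)\mid c>r\}$. - $G_{1,2}$: two distinct squares are adjacent iff they are both in $V_1$ or both in $V_2$, and they lie in the same row, the same column, or the same diagonal parallel to the main diagonal ($r-c$ constant). (Its two components are isomorphic to the triangular graphs $\mathcal{T}(n)$ and $\mathcal{T}(n-1)$, where $\mathcal{T}(m)$ has vertices $(i,j)$, $1\le j\le i\le m$, distinct vertices $(i,j),(k,\ell)$ being adjacent iff $i=k$ or $j=\ell$ or $i-j=k-\ell$.) - $G_3$: has edge set $E(\mathcal{Q}(n))\setminus E(G_{1,2})$. - $G_3^1$: two distinct squares are adjacent iff they lie on the same diagonal parallel to the second diagonal ($r+c$ constant). - $G_3^2$: has edge set $E(G_3)\setminus E(G_3^1)$. - $G_{3,H}^2$ (respectively $G_{3,V}^2$): a square of $V_1$ and a square of $V_2$ are adjacent iff they lie in the same row (respectively the same column); there are no other edges. The adjacency matrices satisfy $A(\mathcal{Q}(n))=A(G_{1,2})+A(G_3)$, $A(G_3)=A(G_3^1)+A(G_3^2)$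 and $A(G_3^2)=A(G_{3,H}^2)+A(G_{3,V}^2)$. *)

theory Defs
  imports "Jordan_Normal_Form.Char_Poly"
begin

text \<open>
  A simple graph is given by a list \<open>vs\<close> enumerating its vertices without repetition and a set of
  edges, an edge being a two-element set of vertices.
\<close>

definition adj_matrix :: "'a list \<Rightarrow> 'a set set \<Rightarrow> real mat" where
  "adj_matrix vs E =
     mat (length vs) (length vs) (\<lambda>(a, b). if {vs ! a, vs ! b} \<in> E then 1 else 0)"

text \<open>
  The eigenvalues in non-increasing order, listed with their multiplicity as roots of the
  characteristic polynomial. For a real symmetric matrix of size \<open>m\<close> this list has length \<open>m\<close>,
  as all complex roots are real.
\<close>

definition eigenvalue_list :: "real mat \<Rightarrow> real list" where
  "eigenvalue_list A = rev (sorted_list_of_multiset (proots (char_poly A)))"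

text \<open>The \<open>k\<close>-th largest eigenvalue, where \<open>k\<close> counts from 1.\<close>

definition graph_eigenvalue :: "'a list \<Rightarrow> 'a set set \<Rightarrow> nat \<Rightarrow> real" where
  "graph_eigenvalue vs E k = eigenvalue_list (adj_matrix vs E) ! (k - 1)"

type_synonym square = "nat \<times> nat"

definition squares :: "nat \<Rightarrow> square list" where
  "squares n = List.product [1..<n + 1] [1..<n + 1]"

definition edges_of :: "'a list \<Rightarrow> ('a \<Rightarrow> 'a \<Rightarrow> bool) \<Rightarrow> 'a set set" where
  "edges_of vs P = {{u, v} | u v. u \<in> set vs \<and> v \<in> set vs \<and> u \<noteq> v \<and> P u v}"

definition same_row :: "square \<Rightarrow> square \<Rightarrow> bool" where
  "same_row u v \<longleftrightarrow> fst u = fst v"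

definition same_col :: "square \<Rightarrow> square \<Rightarrow> bool" where
  "same_col u v \<longleftrightarrow> snd u = snd v"

definition same_diag :: "square \<Rightarrow> square \<Rightarrow> bool" where
  "same_diag u v \<longleftrightarrow> int (fst u) - int (snd u) = int (fst v) - int (snd v)"

definition same_antidiag :: "square \<Rightarrow> square \<Rightarrow> bool" where
  "same_antidiag u v \<longleftrightarrow> fst u + snd u = fst v + snd v"

definition V1 :: "nat \<Rightarrow> square set" where
  "V1 n = {u \<in> set (squares n). snd u \<le> fst u}"

definition V2 :: "nat \<Rightarrow> square set" where
  "V2 n = {u \<in> set (squares n). snd u > fst u}"

definition queens :: "nat \<Rightarrow> square set set" where
  "queens n = edges_of (squares n)
     (\<lambda>u v. same_row u v \<or> same_col u v \<or> same_diag u v \<or> same_antidiag u v)"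

definition G12 :: "nat \<Rightarrow> square set set" where
  "G12 n = edges_of (squares n)
     (\<lambda>u v. (u \<in> V1 n \<and> v \<in> V1 n \<or> u \<in> V2 n \<and> v \<in> V2 n) \<and>
            (same_row u v \<or> same_col u v \<or> same_diag u v))"

definition G3 :: "nat \<Rightarrow> square set set" where
  "G3 n = queens n - G12 n"

definition G31 :: "nat \<Rightarrow> square set set" where
  "G31 n = edges_of (squares n) same_antidiag"

definition G32 :: "nat \<Rightarrow> square set set" where
  "G32 n = G3 n - G31 n"

definition G32H :: "nat \<Rightarrow> square set set" where
  "G32H n = edges_of (squares n) (\<lambda>u v. u \<in> V1 n \<and> v \<in> V2 n \<and> same_row u v)"

definition G32V :: "nat \<Rightarrow> square set set" where
  "G32V n = edges_of (squares n) (\<lambda>u v. u \<in> V1 n \<and> v \<in> V2 n \<and> same_col u v)"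

text \<open>All these graphs have the vertex set of the \<open>n \<times> n\<close> board.\<close>

abbreviation eig :: "(nat \<Rightarrow> square set set) \<Rightarrow> nat \<Rightarrow> nat \<Rightarrow> real" where
  "eig G n k \<equiv> graph_eigenvalue (squares n) (G n) k"

end

theory Submission
  imports Defs
begin

text \<open>
  All six bounds are instances of Weyl's inequalities for sums of real symmetric matrices. The edge
  set of the Queens' graph is the disjoint union of those of \<open>G12\<close> and \<open>G3\<close>, the edge set of \<open>G3\<close>
  is the disjoint union of those of \<open>G31\<close> and \<open>G32\<close>, and that of \<open>G32\<close> of those of \<open>G32H\<close> and
  \<open>G32V\<close>. Adjacency matrices of edge-disjoint graphs on the same vertices add up, so each
  splitting yields one upper and one lower bound. The equalities between the bounds restate the
  assumed relations between the indices.

  The three splittings rest on two facts about the board: two distinct squares on an antidiagonal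
  share no row, column or main-parallel diagonal (\<open>antidiag_meets_lines_once\<close>), and a diagonal
  parallel to the main one stays on one side of it (\<open>same_diag_same_half\<close>).

  Weyl's inequalities (\<open>weyl_upper\<close>, \<open>weyl_lower\<close>) come from a dimension count. Let \<open>m\<close> be the size
  of the matrices. A real symmetric matrix has an orthonormal basis of eigenvectors ordered by
  eigenvalue (\<open>symmetric_eigenbasis\<close>), and orthogonality to an initial or final segment of this
  basis bounds the quadratic form by one eigenvalue (\<open>rayleigh_le\<close>, \<open>rayleigh_ge\<close>). For suitable
  segments of the eigenbases of \<open>A\<close>, \<open>B\<close> and \<open>A + B\<close>, the orthogonality conditions number \<open>m - 1\<close>, so
  a nonzero vector satisfies all of them (\<open>exists_vector_orthogonal_to_list\<close>). Comparing the three
  quadratic forms at this vector compares the three eigenvalues.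
\<close>

section \<open>Orthogonal diagonalization of real symmetric matrices\<close>

lemma transpose_symmetricD:
  fixes A :: "'a mat"
  assumes "A \<in> carrier_mat m m" "transpose_mat A = A" "i < m" "j < m"
  shows "A $$ (i, j) = A $$ (j, i)"
  using assms by (metis carrier_matD index_transpose_mat(1))

text \<open>
  Some complex \<open>z\<close> is a root of the characteristic polynomial. If \<open>v\<close> is a complex eigenvector
  for it, the Hermitian form of \<open>v\<close> equals both \<open>z \<cdot> \<parallel>v\<parallel>\<^sup>2\<close> and, by symmetry of the matrix, its own
  conjugate; so \<open>z\<close> is real. A real root of the characteristic polynomial has a real eigenvector.
\<close>

lemma symmetric_real_eigenvector:
  fixes A :: "real mat"
  assumes A: "A \<in> carrier_mat m m" and sym: "transpose_mat A = A" and "m > 0"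
  shows "\<exists>v e. v \<in> carrier_vec m \<and> v \<noteq> 0\<^sub>v m \<and> A *\<^sub>v v = e \<cdot>\<^sub>v v"
proof -
  define C where "C = map_mat complex_of_real A"
  have C: "C \<in> carrier_mat m m" using A by (simp add: C_def)
  have "degree (char_poly C) = m" using degree_monic_char_poly[OF C] by simp
  then obtain z where z: "poly (char_poly C) z = 0"
    using \<open>m > 0\<close> fundamental_theorem_of_algebra[of "char_poly C"] constant_degree[of "char_poly C"]
    by auto
  hence "eigenvalue C z" by (simp add: eigenvalue_root_char_poly[OF C])
  then obtain v where v: "v \<in> carrier_vec m" "v \<noteq> 0\<^sub>v m" "C *\<^sub>v v = z \<cdot>\<^sub>v v"
    using C unfolding eigenvalue_def eigenvector_def by auto
  define N where "N = (\<Sum>i<m. (cmod (v $ i))\<^sup>2)"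
  \<comment> \<open>\<open>S\<close> is the Hermitian form \<open>v\<^sup>* A v\<close>.\<close>
  define S where "S = (\<Sum>i<m. \<Sum>j<m. complex_of_real (A $$ (i, j)) * v $ j * cnj (v $ i))"
  obtain k where k: "k < m" "v $ k \<noteq> 0"
    using v by (metis carrier_vecD eq_vecI index_zero_vec)
  have "N > 0" unfolding N_def by (rule sum_pos2[of _ k]) (use k in auto)
  have "cnj S = (\<Sum>i<m. \<Sum>j<m. complex_of_real (A $$ (i, j)) * cnj (v $ j) * v $ i)"
    by (simp add: S_def)
  also have "\<dots> = (\<Sum>j<m. \<Sum>i<m. complex_of_real (A $$ (i, j)) * cnj (v $ j) * v $ i)"
    by (rule sum.swap)
  also have "\<dots> = S"
    unfolding S_def by (intro sum.cong refl) (simp add: transpose_symmetricD[OF A sym] ac_simps)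
  finally have real_S: "cnj S = S" .
  have row: "(\<Sum>j<m. complex_of_real (A $$ (i, j)) * v $ j) = z * v $ i" if "i < m" for i
  proof -
    have "(C *\<^sub>v v) $ i = (\<Sum>j<m. complex_of_real (A $$ (i, j)) * v $ j)"
      using that A v(1) by (simp add: C_def scalar_prod_def lessThan_atLeast0)
    thus ?thesis using v that by simp
  qed
  have "S = (\<Sum>i<m. z * v $ i * cnj (v $ i))"
    unfolding S_def by (simp add: row flip: sum_distrib_right)
  also have "\<dots> = z * complex_of_real N"
    unfolding N_def by (simp add: sum_distrib_left complex_norm_square mult.assoc del: of_real_power)
  finally have "S = z * complex_of_real N" .
  with real_S \<open>N > 0\<close> have "cnj z = z" by simp
  then obtain e where e: "z = complex_of_real e" by (metis Reals_cnj_iff Reals_cases)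
  have "char_poly C = map_poly complex_of_real (char_poly A)"
    unfolding C_def by (rule of_real_hom.char_poly_hom[OF A])
  with z e have "poly (char_poly A) e = 0" by simp
  hence "eigenvalue A e" by (simp add: eigenvalue_root_char_poly[OF A])
  thus ?thesis using A unfolding eigenvalue_def eigenvector_def by auto
qed

text \<open>
  The Householder reflection in the hyperplane orthogonal to \<open>v - e\<^sub>0\<close> exchanges the unit vectors
  \<open>e\<^sub>0\<close> and \<open>v\<close> if they differ, and a reflection is orthogonal.
\<close>

lemma exists_orthogonal_matrix_first_col:
  fixes v :: "real vec"
  assumes v: "v \<in> carrier_vec m" and unit: "v \<bullet> v = 1" and "m > 0"
  shows "\<exists>W \<in> carrier_mat m m. transpose_mat W * W = 1\<^sub>m m \<and> col W 0 = v"
proof (cases "v = unit_vec m 0")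
  case True
  thus ?thesis using \<open>m > 0\<close> by (intro bexI[of _ "1\<^sub>m m"]) auto
next
  case False
  define w where "w = v - unit_vec m 0"
  define c where "c = 2 / (w \<bullet> w)"
  define W where "W = mat m m (\<lambda>(i, j). (if i = j then 1 else 0) - c * w $ i * w $ j)"
  have w: "w \<in> carrier_vec m" using v by (simp add: w_def)
  have wi: "w $ i = v $ i - (if i = 0 then 1 else 0)" if "i < m" for i
    using that v \<open>m > 0\<close> by (auto simp: w_def)
  have "w \<bullet> w = v \<bullet> v - 2 * v $ 0 + 1"
  proof -
    have "w \<bullet> w = (\<Sum>i<m. (w $ i)\<^sup>2)"
      using w by (simp add: scalar_prod_def lessThan_atLeast0 power2_eq_square)
    also have "\<dots> = (\<Sum>i<m. v $ i * v $ i + (if i = 0 then 1 - 2 * v $ 0 else 0))"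
      by (intro sum.cong refl) (auto simp: wi power2_eq_square algebra_simps)
    also have "\<dots> = v \<bullet> v + (1 - 2 * v $ 0)"
      using v \<open>m > 0\<close> by (simp add: scalar_prod_def lessThan_atLeast0 sum.distrib)
    finally show ?thesis by simp
  qed
  \<comment> \<open>This identity, a consequence of \<open>v\<close> being a unit vector, makes the reflection send \<open>e\<^sub>0\<close> to \<open>v\<close>.\<close>
  hence ww: "w \<bullet> w = - 2 * w $ 0" using unit wi[OF \<open>m > 0\<close>] by simp
  have "w \<bullet> w \<noteq> 0"
  proof
    assume "w \<bullet> w = 0"
    hence "(\<Sum>i<m. (w $ i)\<^sup>2) = 0"
      using w by (simp add: scalar_prod_def lessThan_atLeast0 power2_eq_square)
    hence "\<forall>i<m. w $ i = 0" by (subst (asm) sum_nonneg_eq_0_iff) auto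
    hence "v = unit_vec m 0" using v wi by (intro eq_vecI) (auto simp: unit_vec_def)
    with False show False by simp
  qed
  hence c: "c * (w \<bullet> w) = 2" and c0: "c * w $ 0 = -1" using ww by (auto simp: c_def)
  have W: "W \<in> carrier_mat m m" by (simp add: W_def)
  have "transpose_mat W * W = 1\<^sub>m m"
  proof (rule eq_matI)
    fix i j assume "i < dim_row (1\<^sub>m m :: real mat)" "j < dim_col (1\<^sub>m m :: real mat)"
    hence ij: "i < m" "j < m" by auto
    have "(transpose_mat W * W) $$ (i, j) = (\<Sum>k<m. W $$ (k, i) * W $$ (k, j))"
      using ij W by (simp add: scalar_prod_def lessThan_atLeast0)
    also have "\<dots> = (\<Sum>k<m. (if k = i then (if i = j then 1 else 0) - c * w $ i * w $ j else 0)
        - (if k = j then c * w $ i * w $ j else 0) + c * w $ i * (c * w $ j) * (w $ k * w $ k))"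
      using ij by (intro sum.cong refl) (auto simp: W_def algebra_simps)
    also have "\<dots> = (if i = j then 1 else 0) - 2 * (c * w $ i * w $ j)
        + c * w $ i * (c * w $ j) * (w \<bullet> w)"
      using ij w by (simp add: sum.distrib sum_subtractf sum_distrib_left[symmetric] scalar_prod_def
          lessThan_atLeast0)
    also have "\<dots> = (if i = j then 1 else 0) + (c * (w \<bullet> w) - 2) * (c * w $ i * w $ j)"
      by (simp add: algebra_simps)
    finally show "(transpose_mat W * W) $$ (i, j) = 1\<^sub>m m $$ (i, j)" using ij c by simp
  qed (use W in auto)
  moreover have "col W 0 = v"
  proof (rule eq_vecI)
    fix i assume "i < dim_vec v"
    hence i: "i < m" using v by simp
    have "col W 0 $ i = (if i = 0 then 1 else 0) - (c * w $ 0) * w $ i"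
      using i \<open>m > 0\<close> by (simp add: W_def)
    thus "col W 0 $ i = v $ i" using c0 wi[OF i] by simp
  qed (use v W in auto)
  ultimately show ?thesis using W by blast
qed

text \<open>
  Induction on the size. In orthonormal coordinates whose first vector is a unit eigenvector, the
  first column of the matrix vanishes below the diagonal; the matrix is still symmetric, so the
  first row vanishes as well and a symmetric block of smaller size remains. In this version the
  eigenvalues \<open>d\<close> come in no particular order.
\<close>

lemma symmetric_orthogonally_diagonalizable:
  fixes A :: "real mat"
  assumes "A \<in> carrier_mat m m" "transpose_mat A = A"
  shows "\<exists>U d. U \<in> carrier_mat m m \<and> transpose_mat U * U = 1\<^sub>m m
    \<and> transpose_mat U * A * U = mat_diag m d"
  using assms
proof (induction m arbitrary: A)
  case 0
  thus ?case by (intro exI[of _ "1\<^sub>m 0"] exI[of _ "\<lambda>_. 0"]) (auto intro!: eq_matI simp: mat_diag_def)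
next
  case (Suc m)
  note A = Suc.prems(1) and sym = Suc.prems(2)
  obtain v0 e where v0: "v0 \<in> carrier_vec (Suc m)" "v0 \<noteq> 0\<^sub>v (Suc m)" "A *\<^sub>v v0 = e \<cdot>\<^sub>v v0"
    using symmetric_real_eigenvector[OF A sym] by auto
  define v where "v = (1 / sqrt (v0 \<bullet> v0)) \<cdot>\<^sub>v v0"
  have v: "v \<in> carrier_vec (Suc m)" using v0 by (simp add: v_def)
  have "v0 \<bullet> v0 > 0"
    using v0 conjugate_square_greater_0_vec[OF v0(1)] by simp
  hence unit: "v \<bullet> v = 1" using v0(1) by (simp add: v_def)
  have ev: "A *\<^sub>v v = e \<cdot>\<^sub>v v"
    using v0 A by (simp add: v_def mult_mat_vec smult_smult_assoc mult.commute)
  obtain W where W: "W \<in> carrier_mat (Suc m) (Suc m)"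
    and orth: "transpose_mat W * W = 1\<^sub>m (Suc m)" and col: "col W 0 = v"
    using exists_orthogonal_matrix_first_col[OF v unit] by auto
  define T where "T = transpose_mat W"
  have T: "T \<in> carrier_mat (Suc m) (Suc m)" using W by (simp add: T_def)
  define A' where "A' = T * A * W"
  have A': "A' \<in> carrier_mat (Suc m) (Suc m)" using A W T by (simp add: A'_def)
  have "transpose_mat A' = transpose_mat W * (transpose_mat A * transpose_mat T)"
    unfolding A'_def
    by (subst transpose_mult[of _ "Suc m" "Suc m" _ "Suc m"], use A W T in simp, use W in simp,
        subst transpose_mult[of _ "Suc m" "Suc m" _ "Suc m"], use A W T in auto)
  hence sym': "transpose_mat A' = A'"
    using assoc_mult_mat[OF T A W] by (simp add: A'_def sym T_def)
  have first_col: "A' $$ (i, 0) = (if i = 0 then e else 0)" if "i < Suc m" for i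
  proof -
    have "col A' 0 = T *\<^sub>v (A *\<^sub>v col W 0)"
      unfolding A'_def assoc_mult_mat[OF T A W]
      using col_mult2[OF T mult_carrier_mat[OF A W], of 0] col_mult2[OF A W, of 0] by simp
    also have "\<dots> = e \<cdot>\<^sub>v (T *\<^sub>v col W 0)"
      using T v by (simp add: col ev mult_mat_vec)
    also have "T *\<^sub>v col W 0 = col (T * W) 0"
      using col_mult2[OF T W, of 0] by simp
    finally have "col A' 0 = e \<cdot>\<^sub>v unit_vec (Suc m) 0" using orth by (simp add: T_def)
    hence "col A' 0 $ i = (e \<cdot>\<^sub>v unit_vec (Suc m) 0) $ i" by simp
    thus ?thesis using that A' by auto
  qed
  define B where "B = mat m m (\<lambda>(i, j). A' $$ (Suc i, Suc j))"
  have B: "B \<in> carrier_mat m m" by (simp add: B_def)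
  have "transpose_mat B = B"
    by (rule eq_matI) (auto simp: B_def transpose_symmetricD[OF A' sym'])
  then obtain Q d where Q: "Q \<in> carrier_mat m m" "transpose_mat Q * Q = 1\<^sub>m m"
    "transpose_mat Q * B * Q = mat_diag m d"
    using Suc.IH[OF B] by blast
  have A'_block: "A' = four_block_mat (e \<cdot>\<^sub>m 1\<^sub>m 1) (0\<^sub>m 1 m) (0\<^sub>m m 1) B"
  proof (rule eq_matI)
    fix i j
    assume "i < dim_row (four_block_mat (e \<cdot>\<^sub>m 1\<^sub>m 1) (0\<^sub>m 1 m) (0\<^sub>m m 1) B)"
      "j < dim_col (four_block_mat (e \<cdot>\<^sub>m 1\<^sub>m 1) (0\<^sub>m 1 m) (0\<^sub>m m 1) B)"
    hence ij: "i < Suc m" "j < Suc m" using B by auto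
    show "A' $$ (i, j) = four_block_mat (e \<cdot>\<^sub>m 1\<^sub>m 1) (0\<^sub>m 1 m) (0\<^sub>m m 1) B $$ (i, j)"
      using ij B first_col[of i] first_col[of j] transpose_symmetricD[OF A' sym', of i j]
      by (cases i; cases j) (auto simp: B_def)
  qed (use A' B in auto)
  define R where "R = four_block_mat (1\<^sub>m 1) (0\<^sub>m 1 m) (0\<^sub>m m 1) Q"
  have R: "R \<in> carrier_mat (Suc m) (Suc m)" using Q by (auto simp: R_def)
  have RT: "transpose_mat R = four_block_mat (1\<^sub>m 1) (0\<^sub>m 1 m) (0\<^sub>m m 1) (transpose_mat Q)"
    unfolding R_def
    by (subst transpose_four_block_mat[of _ 1 1 _ m _ m]) (use Q in \<open>auto simp: zero_transpose_mat\<close>)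
  have RTc: "transpose_mat R \<in> carrier_mat (Suc m) (Suc m)" using R by simp
  have orth_R: "transpose_mat R * R = 1\<^sub>m (Suc m)"
    unfolding RT unfolding R_def
    by (subst mult_four_block_mat[of _ 1 1 _ m _ m _ _ 1 _ m]) (use Q in auto)
  have diag_R: "transpose_mat R * A' * R = mat_diag (Suc m) (case_nat e d)"
  proof -
    have "transpose_mat R * A' * R
      = four_block_mat (e \<cdot>\<^sub>m 1\<^sub>m 1) (0\<^sub>m 1 m) (0\<^sub>m m 1) (transpose_mat Q * B * Q)"
      unfolding RT A'_block unfolding R_def
      using Q B by (simp add: mult_four_block_mat[of _ 1 1 _ m _ m _ _ 1 _ m])
    also have "\<dots> = mat_diag (Suc m) (case_nat e d)"
      unfolding Q(3) by (rule eq_matI) (auto simp: mat_diag_def split: nat.splits)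
    finally show ?thesis .
  qed
  define U where "U = W * R"
  have U: "U \<in> carrier_mat (Suc m) (Suc m)" using W R by (simp add: U_def)
  have UT: "transpose_mat U = transpose_mat R * T"
    unfolding U_def T_def by (rule transpose_mult[OF W R])
  have "transpose_mat U * U = transpose_mat R * (T * W) * R"
    unfolding UT unfolding U_def using RTc T W R
    by (simp add: assoc_mult_mat[of _ "Suc m" "Suc m" _ "Suc m" _ "Suc m"])
  hence "transpose_mat U * U = 1\<^sub>m (Suc m)"
    using orth orth_R RTc R by (simp add: T_def)
  moreover have "transpose_mat U * A * U = transpose_mat R * A' * R"
    unfolding UT unfolding U_def A'_def using RTc T W R A
    by (simp add: assoc_mult_mat[of _ "Suc m" "Suc m" _ "Suc m" _ "Suc m"])
  ultimately show ?case using U diag_R by metis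
qed

section \<open>Eigenbases in the order of the eigenvalues\<close>

definition orthonormal_basis :: "nat \<Rightarrow> (nat \<Rightarrow> real vec) \<Rightarrow> bool" where
  "orthonormal_basis m u \<longleftrightarrow> (\<forall>k<m. u k \<in> carrier_vec m) \<and>
     (\<forall>k<m. \<forall>l<m. u k \<bullet> u l = (if k = l then 1 else 0))"

text \<open>
  With the \<open>u k\<close> as the rows of a square matrix \<open>T\<close>, orthonormality says \<open>T T\<^sup>T = 1\<close>. A one-sided
  inverse of a square matrix is two-sided, hence \<open>T\<^sup>T T = 1\<close> and \<open>T\<close> preserves scalar products.
\<close>

lemma parseval:
  assumes u: "orthonormal_basis m u" and x: "x \<in> carrier_vec m" and y: "y \<in> carrier_vec m"
  shows "x \<bullet> y = (\<Sum>k<m. (u k \<bullet> x) * (u k \<bullet> y))"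
proof -
  define T where "T = mat_of_rows m (map u [0..<m])"
  have T: "T \<in> carrier_mat m m" using mat_of_rows_carrier(1)[of m "map u [0..<m]"] by (simp add: T_def)
  have row: "row T k = u k" if "k < m" for k
    using that u by (simp add: T_def orthonormal_basis_def)
  have "T * transpose_mat T = 1\<^sub>m m"
    by (rule eq_matI) (use T u in \<open>auto simp: row orthonormal_basis_def\<close>)
  hence inv: "transpose_mat T * T = 1\<^sub>m m"
    using mat_mult_left_right_inverse[OF T _ \<open>T * transpose_mat T = 1\<^sub>m m\<close>] T by simp
  have "x \<bullet> y = x \<bullet> (transpose_mat T *\<^sub>v (T *\<^sub>v y))"
    using assoc_mult_mat_vec[of "transpose_mat T" m m T m y] T y inv by simp
  also have "\<dots> = (T *\<^sub>v x) \<bullet> (T *\<^sub>v y)"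
    using T x y transpose_vec_mult_scalar[of T m m x "T *\<^sub>v y"] comm_scalar_prod[of _ m]
    by (metis mult_mat_vec_carrier transpose_carrier_mat)
  also have "\<dots> = (\<Sum>k<m. (u k \<bullet> x) * (u k \<bullet> y))"
    using T by (simp add: scalar_prod_def[of "T *\<^sub>v x"] row lessThan_atLeast0)
  finally show ?thesis .
qed

definition eigenbasis :: "nat \<Rightarrow> real mat \<Rightarrow> real list \<Rightarrow> (nat \<Rightarrow> real vec) \<Rightarrow> bool" where
  "eigenbasis m A es u \<longleftrightarrow> orthonormal_basis m u \<and> (\<forall>k<m. A *\<^sub>v u k = es ! k \<cdot>\<^sub>v u k)"

lemma eigenvalue_list_of_diagonalization:
  fixes A U :: "real mat"
  assumes A: "A \<in> carrier_mat m m" and U: "U \<in> carrier_mat m m"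
    and orth: "transpose_mat U * U = 1\<^sub>m m" and diag: "transpose_mat U * A * U = mat_diag m d"
  shows "eigenvalue_list A = rev (sort (map d [0..<m]))"
proof -
  have UT: "transpose_mat U \<in> carrier_mat m m" using U by simp
  have orth': "U * transpose_mat U = 1\<^sub>m m"
    by (rule mat_mult_left_right_inverse[OF UT U orth])
  have "similar_mat (mat_diag m d) A"
    by (rule similar_matI[of _ _ "transpose_mat U" U m]) (use A U orth orth' diag in auto)
  hence "char_poly A = char_poly (mat_diag m d)" by (simp add: char_poly_similar)
  also have "\<dots> = (\<Prod>a\<leftarrow>diag_mat (mat_diag m d). [:- a, 1:])"
    by (rule char_poly_upper_triangular[of _ m]) (auto simp: upper_triangular_def mat_diag_def)
  also have "diag_mat (mat_diag m d) = map d [0..<m]"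
    by (auto simp: diag_mat_def mat_diag_def)
  finally have cp: "char_poly A = (\<Prod>a\<leftarrow>map d [0..<m]. [:- a, 1:])" .
  have "proots (\<Prod>a\<leftarrow>xs. [:- a, 1:]) = mset xs" for xs :: "real list"
    by (induction xs) (simp_all add: proots_mult prod_list_zero_iff image_iff del: mult_pCons_left)
  thus ?thesis unfolding eigenvalue_list_def cp by (simp only: sorted_list_of_multiset_mset)
qed

text \<open>
  The diagonal entries of a diagonalization are the eigenvalues with multiplicity, and permuting the
  columns of the diagonalizing matrix puts them into non-increasing order. The length is part of
  the conclusion because the list holds only the real roots of the characteristic polynomial; all
  positions below \<open>m\<close> are meaningful because all roots are real.
\<close>

lemma symmetric_eigenbasis:
  fixes A :: "real mat"
  assumes A: "A \<in> carrier_mat m m" and sym: "transpose_mat A = A"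
  shows "length (eigenvalue_list A) = m \<and> (\<exists>u. eigenbasis m A (eigenvalue_list A) u)"
proof -
  obtain U d where U: "U \<in> carrier_mat m m" and orth: "transpose_mat U * U = 1\<^sub>m m"
    and diag: "transpose_mat U * A * U = mat_diag m d"
    using symmetric_orthogonally_diagonalizable[OF A sym] by blast
  have UT: "transpose_mat U \<in> carrier_mat m m" using U by simp
  have orth': "U * transpose_mat U = 1\<^sub>m m"
    by (rule mat_mult_left_right_inverse[OF UT U orth])
  note es = eigenvalue_list_of_diagonalization[OF A U orth diag]
  have len: "length (eigenvalue_list A) = m" by (simp add: es)
  have "mset (eigenvalue_list A) = mset (map d [0..<m])" by (simp add: es)
  then obtain p where p: "p permutes {..<m}" "permute_list p (map d [0..<m]) = eigenvalue_list A"
    using mset_eq_permutation by (metis diff_zero length_map length_upt)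
  have pm: "p k < m" if "k < m" for k using p(1) that permutes_in_image[of p "{..<m}" k] by simp
  have nth: "eigenvalue_list A ! k = d (p k)" if "k < m" for k
    using p that pm by (metis permute_list_nth add_0 diff_zero length_map length_upt nth_map nth_upt)
  have "U * mat_diag m d = (U * transpose_mat U) * A * U"
    unfolding diag[symmetric] using U UT A
    by (simp add: assoc_mult_mat[of _ m m _ m _ m])
  hence AU: "A * U = U * mat_diag m d" using A orth' by simp
  have eig: "A *\<^sub>v col U k = d k \<cdot>\<^sub>v col U k" if "k < m" for k
  proof -
    have "A *\<^sub>v col U k = col (U * mat_diag m d) k"
      using col_mult2[OF A U that] unfolding AU by simp
    also have "\<dots> = d k \<cdot>\<^sub>v col U k"
      using that U by (intro eq_vecI) (auto simp: mat_diag_mult_right[of _ m])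
    finally show ?thesis .
  qed
  have "col U k \<bullet> col U l = (if k = l then 1 else 0)" if "k < m" "l < m" for k l
    using arg_cong[OF orth, of "\<lambda>M. M $$ (k, l)"] that U by simp
  hence "orthonormal_basis m (\<lambda>k. col U (p k))"
    using U pm permutes_inj[OF p(1)] by (auto simp: orthonormal_basis_def inj_eq)
  hence "eigenbasis m A (eigenvalue_list A) (\<lambda>k. col U (p k))"
    by (auto simp: eigenbasis_def nth eig pm)
  with len show ?thesis by blast
qed

lemma eigenvalue_list_antimono:
  assumes "k \<le> l" "l < length (eigenvalue_list A)"
  shows "eigenvalue_list A ! l \<le> eigenvalue_list A ! k"
proof -
  have "sorted (rev (eigenvalue_list A))" by (simp add: eigenvalue_list_def)
  thus ?thesis using assms sorted_rev_nth_mono by blast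
qed

section \<open>Rayleigh bounds and Weyl's inequalities\<close>

lemma quadratic_form_eigenbasis:
  assumes A: "A \<in> carrier_mat m m" and sym: "transpose_mat A = A"
    and u: "eigenbasis m A es u" and x: "x \<in> carrier_vec m"
  shows "x \<bullet> (A *\<^sub>v x) = (\<Sum>k<m. es ! k * (u k \<bullet> x)\<^sup>2)"
proof -
  have ob: "orthonormal_basis m u" using u by (simp add: eigenbasis_def)
  have "u k \<bullet> (A *\<^sub>v x) = es ! k * (u k \<bullet> x)" if "k < m" for k
  proof -
    have uk: "u k \<in> carrier_vec m" using ob that by (simp add: orthonormal_basis_def)
    have "u k \<bullet> (A *\<^sub>v x) = (A *\<^sub>v u k) \<bullet> x"
      using transpose_vec_mult_scalar[OF A x uk] sym by simp
    thus ?thesis using u that uk x by (simp add: eigenbasis_def)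
  qed
  thus ?thesis
    using parseval[OF ob x, of "A *\<^sub>v x"] A x
    by (simp add: power2_eq_square ac_simps)
qed

text \<open>
  On vectors without components along the first \<open>p\<close> basis vectors, only the eigenvalues from
  position \<open>p\<close> on (counting from 0) contribute to the quadratic form, and the largest of these is
  the one at \<open>p\<close>. Dually, removing the components after \<open>p\<close> bounds the form from below.
\<close>

lemma rayleigh_le:
  assumes A: "A \<in> carrier_mat m m" and sym: "transpose_mat A = A"
    and u: "eigenbasis m A (eigenvalue_list A) u" and x: "x \<in> carrier_vec m" and "p < m"
    and orth: "\<And>k. k < p \<Longrightarrow> u k \<bullet> x = 0"
  shows "x \<bullet> (A *\<^sub>v x) \<le> eigenvalue_list A ! p * (x \<bullet> x)"
proof -
  have len: "length (eigenvalue_list A) = m" using symmetric_eigenbasis[OF A sym] by simp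
  have ob: "orthonormal_basis m u" using u by (simp add: eigenbasis_def)
  have "(\<Sum>k<m. eigenvalue_list A ! k * (u k \<bullet> x)\<^sup>2) \<le> (\<Sum>k<m. eigenvalue_list A ! p * (u k \<bullet> x)\<^sup>2)"
  proof (rule sum_mono)
    fix k assume k: "k \<in> {..<m}"
    show "eigenvalue_list A ! k * (u k \<bullet> x)\<^sup>2 \<le> eigenvalue_list A ! p * (u k \<bullet> x)\<^sup>2"
      using orth[of k] eigenvalue_list_antimono[of p k A] k
      by (cases "k < p") (auto simp: len intro: mult_right_mono)
  qed
  also have "\<dots> = eigenvalue_list A ! p * (x \<bullet> x)"
    by (simp add: parseval[OF ob x x] sum_distrib_left power2_eq_square)
  finally show ?thesis by (simp add: quadratic_form_eigenbasis[OF A sym u x])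
qed

lemma rayleigh_ge:
  assumes A: "A \<in> carrier_mat m m" and sym: "transpose_mat A = A"
    and u: "eigenbasis m A (eigenvalue_list A) u" and x: "x \<in> carrier_vec m" and "p < m"
    and orth: "\<And>k. p < k \<Longrightarrow> k < m \<Longrightarrow> u k \<bullet> x = 0"
  shows "eigenvalue_list A ! p * (x \<bullet> x) \<le> x \<bullet> (A *\<^sub>v x)"
proof -
  have len: "length (eigenvalue_list A) = m" using symmetric_eigenbasis[OF A sym] by simp
  have ob: "orthonormal_basis m u" using u by (simp add: eigenbasis_def)
  have "eigenvalue_list A ! p * (x \<bullet> x) = (\<Sum>k<m. eigenvalue_list A ! p * (u k \<bullet> x)\<^sup>2)"
    by (simp add: parseval[OF ob x x] sum_distrib_left power2_eq_square)
  also have "\<dots> \<le> (\<Sum>k<m. eigenvalue_list A ! k * (u k \<bullet> x)\<^sup>2)"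
  proof (rule sum_mono)
    fix k assume k: "k \<in> {..<m}"
    show "eigenvalue_list A ! p * (u k \<bullet> x)\<^sup>2 \<le> eigenvalue_list A ! k * (u k \<bullet> x)\<^sup>2"
      using orth[of k] eigenvalue_list_antimono[of k p A] k \<open>p < m\<close>
      by (cases "p < k") (auto simp: len intro: mult_right_mono)
  qed
  finally show ?thesis by (simp add: quadratic_form_eigenbasis[OF A sym u x])
qed

text \<open>
  Fewer than \<open>m\<close> homogeneous linear equations in \<open>m\<close> unknowns have a nontrivial solution: padded
  with zero rows they form a square matrix, which is singular because its last row is zero.
\<close>

lemma exists_vector_orthogonal_to_list:
  fixes fs :: "'a :: field vec list"
  assumes "set fs \<subseteq> carrier_vec m" "length fs < m"
  shows "\<exists>x \<in> carrier_vec m. x \<noteq> 0\<^sub>v m \<and> (\<forall>f \<in> set fs. f \<bullet> x = 0)"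
proof -
  define gs where "gs = fs @ replicate (m - length fs) (0\<^sub>v m)"
  define M where "M = mat_of_rows m gs"
  have len: "length gs = m" using assms(2) by (simp add: gs_def)
  have gs: "set gs \<subseteq> carrier_vec m" using assms(1) by (auto simp: gs_def)
  have M: "M \<in> carrier_mat m m" using len by (auto simp: M_def)
  have row: "row M k = gs ! k" if "k < m" for k
    using that gs len nth_mem[of k gs] unfolding M_def by (intro mat_of_rows_row) auto
  have "row M (m - 1) = 0\<^sub>v m" 
  proof -
    have "m - 1 < m" "\<not> m - 1 < length fs" using assms(2) by auto
    thus ?thesis by (simp only: row gs_def nth_append) simp
  qed
  hence "transpose_mat M *\<^sub>v unit_vec m (m - 1) = 0\<^sub>v m"
    
  proof -
    assume zero_row: "row M (m - 1) = 0\<^sub>v m"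
    have "M $$ (m - 1, k) = 0" if "k < m" for k
    proof -
      have "M $$ (m - 1, k) = row M (m - 1) $ k" using that M assms(2) by simp
      thus ?thesis using that unfolding zero_row by simp
    qed
    thus ?thesis using M assms(2) by (intro eq_vecI) auto
  qed
  hence "det (transpose_mat M) = 0"
    using M assms(2) by (subst det_0_iff_vec_prod_zero[of _ m]) (auto intro!: exI[of _ "unit_vec m (m - 1)"])
  hence "det M = 0" using M by (simp add: det_transpose)
  then obtain x where x: "x \<in> carrier_vec m" "x \<noteq> 0\<^sub>v m" "M *\<^sub>v x = 0\<^sub>v m"
    using det_0_iff_vec_prod_zero[OF M] by blast
  have "f \<bullet> x = 0" if f: "f \<in> set fs" for f
  proof -
    obtain k where k: "k < length fs" "f = fs ! k" using f by (metis in_set_conv_nth)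
    hence "(M *\<^sub>v x) $ k = f \<bullet> x" using M assms(2) by (simp add: row gs_def nth_append)
    thus ?thesis using x(3) k assms(2) by simp
  qed
  thus ?thesis using x by blast
qed

text \<open>
  Positions count from 0 here. The idea is to test all three matrices on one common vector \<open>x\<close>.
  Asking \<open>x\<close> to be orthogonal to the first \<open>p\<close> eigenvectors of \<open>A\<close>, the first \<open>q\<close> of \<open>B\<close> and the
  \<open>m - 1 - p - q\<close> eigenvectors of \<open>A + B\<close> after position \<open>p + q\<close> imposes only \<open>m - 1\<close> conditions,
  so some \<open>x \<noteq> 0\<close> meets them all, and the Rayleigh bounds at \<open>x\<close> give the inequality.
\<close>

lemma weyl_upper:
  fixes A B :: "real mat"
  assumes A: "A \<in> carrier_mat m m" "transpose_mat A = A"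
    and B: "B \<in> carrier_mat m m" "transpose_mat B = B" and pq: "p + q < m"
  shows "eigenvalue_list (A + B) ! (p + q) \<le> eigenvalue_list A ! p + eigenvalue_list B ! q"
proof -
  have C: "A + B \<in> carrier_mat m m" "transpose_mat (A + B) = A + B"
    using A B by (auto simp: transpose_add)
  obtain u v w where u: "eigenbasis m A (eigenvalue_list A) u"
    and v: "eigenbasis m B (eigenvalue_list B) v"
    and w: "eigenbasis m (A + B) (eigenvalue_list (A + B)) w"
    using symmetric_eigenbasis A B C by meson
  define fs where "fs = map u [0..<p] @ map v [0..<q] @ map w [Suc (p + q)..<m]"
  have "set fs \<subseteq> carrier_vec m" "length fs < m"
    using u v w pq by (auto simp: fs_def eigenbasis_def orthonormal_basis_def)
  then obtain x where x: "x \<in> carrier_vec m" "x \<noteq> 0\<^sub>v m" "\<forall>f \<in> set fs. f \<bullet> x = 0"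
    using exists_vector_orthogonal_to_list by blast
  have "x \<bullet> (A *\<^sub>v x) \<le> eigenvalue_list A ! p * (x \<bullet> x)"
    by (rule rayleigh_le[OF A u x(1)]) (use pq x(3) in \<open>auto simp: fs_def\<close>)
  moreover have "x \<bullet> (B *\<^sub>v x) \<le> eigenvalue_list B ! q * (x \<bullet> x)"
    by (rule rayleigh_le[OF B v x(1)]) (use pq x(3) in \<open>auto simp: fs_def\<close>)
  moreover have "eigenvalue_list (A + B) ! (p + q) * (x \<bullet> x) \<le> x \<bullet> ((A + B) *\<^sub>v x)"
    by (rule rayleigh_ge[OF C w x(1)]) (use pq x(3) in \<open>auto simp: fs_def\<close>)
  moreover have "x \<bullet> ((A + B) *\<^sub>v x) = x \<bullet> (A *\<^sub>v x) + x \<bullet> (B *\<^sub>v x)"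
    using A B x(1) by (simp add: add_mult_distrib_mat_vec[of _ m m] scalar_prod_add_distrib[of _ m])
  ultimately have "eigenvalue_list (A + B) ! (p + q) * (x \<bullet> x)
      \<le> (eigenvalue_list A ! p + eigenvalue_list B ! q) * (x \<bullet> x)"
    by (simp add: distrib_right)
  moreover have "x \<bullet> x > 0" using x conjugate_square_greater_0_vec[OF x(1)] by simp
  ultimately show ?thesis by simp
qed

text \<open>
  The same argument with the roles of first and last eigenvectors exchanged: the conditions now
  number \<open>(m - 1 - p) + (m - 1 - q) + (p + q + 1 - m) = m - 1\<close>. The hypothesis on \<open>p + q\<close> keeps the
  natural-number subtraction exact.
\<close>

lemma weyl_lower:
  fixes A B :: "real mat"
  assumes A: "A \<in> carrier_mat m m" "transpose_mat A = A"
    and B: "B \<in> carrier_mat m m" "transpose_mat B = B"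
    and pq: "p < m" "q < m" "m \<le> p + q + 1"
  shows "eigenvalue_list A ! p + eigenvalue_list B ! q \<le> eigenvalue_list (A + B) ! (p + q + 1 - m)"
proof -
  have C: "A + B \<in> carrier_mat m m" "transpose_mat (A + B) = A + B"
    using A B by (auto simp: transpose_add)
  obtain u v w where u: "eigenbasis m A (eigenvalue_list A) u"
    and v: "eigenbasis m B (eigenvalue_list B) v"
    and w: "eigenbasis m (A + B) (eigenvalue_list (A + B)) w"
    using symmetric_eigenbasis A B C by meson
  define fs where "fs = map u [Suc p..<m] @ map v [Suc q..<m] @ map w [0..<p + q + 1 - m]"
  have "set fs \<subseteq> carrier_vec m" "length fs < m"
    using u v w pq by (auto simp: fs_def eigenbasis_def orthonormal_basis_def)
  then obtain x where x: "x \<in> carrier_vec m" "x \<noteq> 0\<^sub>v m" "\<forall>f \<in> set fs. f \<bullet> x = 0"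
    using exists_vector_orthogonal_to_list by blast
  have "eigenvalue_list A ! p * (x \<bullet> x) \<le> x \<bullet> (A *\<^sub>v x)"
    by (rule rayleigh_ge[OF A u x(1)]) (use pq x(3) in \<open>auto simp: fs_def\<close>)
  moreover have "eigenvalue_list B ! q * (x \<bullet> x) \<le> x \<bullet> (B *\<^sub>v x)"
    by (rule rayleigh_ge[OF B v x(1)]) (use pq x(3) in \<open>auto simp: fs_def\<close>)
  moreover have "x \<bullet> ((A + B) *\<^sub>v x) \<le> eigenvalue_list (A + B) ! (p + q + 1 - m) * (x \<bullet> x)"
    by (rule rayleigh_le[OF C w x(1)]) (use pq x(3) in \<open>auto simp: fs_def\<close>)
  moreover have "x \<bullet> ((A + B) *\<^sub>v x) = x \<bullet> (A *\<^sub>v x) + x \<bullet> (B *\<^sub>v x)"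
    using A B x(1) by (simp add: add_mult_distrib_mat_vec[of _ m m] scalar_prod_add_distrib[of _ m])
  ultimately have "(eigenvalue_list A ! p + eigenvalue_list B ! q) * (x \<bullet> x)
      \<le> eigenvalue_list (A + B) ! (p + q + 1 - m) * (x \<bullet> x)"
    by (simp add: distrib_right)
  moreover have "x \<bullet> x > 0" using x conjugate_square_greater_0_vec[OF x(1)] by simp
  ultimately show ?thesis by simp
qed

section \<open>Eigenvalues of edge-disjoint unions of graphs\<close>

lemma adj_matrix_carrier: "adj_matrix vs E \<in> carrier_mat (length vs) (length vs)"
  by (simp add: adj_matrix_def)

lemma transpose_adj_matrix: "transpose_mat (adj_matrix vs E) = adj_matrix vs E"
  by (rule eq_matI) (auto simp: adj_matrix_def insert_commute)

lemma adj_matrix_disjoint_Un: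
  assumes "E \<inter> F = {}"
  shows "adj_matrix vs (E \<union> F) = adj_matrix vs E + adj_matrix vs F"
  by (rule eq_matI) (use assms in \<open>auto simp: adj_matrix_def\<close>)

lemma graph_eigenvalue_Un_le:
  assumes "E \<inter> F = {}" "1 \<le> i" "1 \<le> j" "i + j \<le> length vs + 1"
  shows "graph_eigenvalue vs (E \<union> F) (i + j - 1) \<le> graph_eigenvalue vs E i + graph_eigenvalue vs F j"
proof -
  have "i + j - 1 - 1 = (i - 1) + (j - 1)" "(i - 1) + (j - 1) < length vs" using assms by auto
  thus ?thesis
    unfolding graph_eigenvalue_def adj_matrix_disjoint_Un[OF assms(1)]
    using weyl_upper[OF adj_matrix_carrier transpose_adj_matrix adj_matrix_carrier transpose_adj_matrix]
    by metis
qed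

lemma graph_eigenvalue_Un_ge:
  assumes "E \<inter> F = {}" "1 \<le> r" "1 \<le> s" "r \<le> length vs" "s \<le> length vs" "length vs + 1 \<le> r + s"
  shows "graph_eigenvalue vs E r + graph_eigenvalue vs F s \<le> graph_eigenvalue vs (E \<union> F) (r + s - length vs)"
proof -
  have "r + s - length vs - 1 = (r - 1) + (s - 1) + 1 - length vs" "r - 1 < length vs" "s - 1 < length vs"
    "length vs \<le> (r - 1) + (s - 1) + 1" using assms by auto
  thus ?thesis
    unfolding graph_eigenvalue_def adj_matrix_disjoint_Un[OF assms(1)]
    using weyl_lower[OF adj_matrix_carrier transpose_adj_matrix adj_matrix_carrier transpose_adj_matrix]
    by metis
qed

section \<open>Splitting the Queens' graph\<close>

lemma length_squares: "length (squares n) = n\<^sup>2"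
  by (simp add: squares_def power2_eq_square)

text \<open>
  The relation \<open>P\<close> need not be symmetric, and an unordered pair is an edge as soon as \<open>P\<close> holds in
  one of the two directions. For \<open>G32H\<close> and \<open>G32V\<close>, whose relations put the first square in \<open>V1\<close>,
  both directions are needed.
\<close>

lemma pair_in_edges_of:
  "{u, v} \<in> edges_of vs P \<longleftrightarrow> u \<in> set vs \<and> v \<in> set vs \<and> u \<noteq> v \<and> (P u v \<or> P v u)"
  by (auto simp: edges_of_def doubleton_eq_iff)

lemma edges_of_doubleton: "e \<in> edges_of vs P \<Longrightarrow> \<exists>u v. e = {u, v}"
  by (auto simp: edges_of_def)

lemma column_meets_row_once:
  assumes "u \<noteq> v" "same_col u v" shows "\<not> same_row u v"
  using assms by (auto simp: same_row_def same_col_def prod_eq_iff)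

lemma antidiag_meets_lines_once:
  assumes "u \<noteq> v" "same_antidiag u v"
  shows "\<not> same_row u v" "\<not> same_col u v" "\<not> same_diag u v"
  using assms
  by (auto simp: same_row_def same_col_def same_diag_def same_antidiag_def prod_eq_iff)

lemma same_line_sym:
  "same_row u v \<longleftrightarrow> same_row v u" "same_col u v \<longleftrightarrow> same_col v u"
  "same_diag u v \<longleftrightarrow> same_diag v u" "same_antidiag u v \<longleftrightarrow> same_antidiag v u"
  by (auto simp: same_row_def same_col_def same_diag_def same_antidiag_def)

text \<open>
  The halves \<open>V1\<close> and \<open>V2\<close> are told apart by the sign of \<open>fst u - snd u\<close>, which is constant on a
  diagonal. So no diagonal edge joins the two halves.
\<close>

lemma same_diag_same_half: "same_diag u v \<Longrightarrow> snd u \<le> fst u \<longleftrightarrow> snd v \<le> fst v"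
  by (auto simp: same_diag_def)

lemma half_iff:
  assumes "u \<in> set (squares n)"
  shows "u \<in> V1 n \<longleftrightarrow> snd u \<le> fst u" "u \<in> V2 n \<longleftrightarrow> \<not> snd u \<le> fst u"
  using assms by (auto simp: V1_def V2_def)

lemma queens_decomposition: "queens n = G12 n \<union> G3 n" "G12 n \<inter> G3 n = {}"
  by (auto simp: G3_def G12_def queens_def edges_of_def)

text \<open>
  Two distinct squares on an antidiagonal share no other line, so \<open>G12\<close> contains no antidiagonal
  edge and \<open>G3\<close> contains them all.
\<close>

lemma G3_decomposition: "G3 n = G31 n \<union> G32 n" "G31 n \<inter> G32 n = {}"
proof -
  have "G31 n \<subseteq> G3 n"
  proof
    fix e assume e: "e \<in> G31 n"
    then obtain u v where uv: "e = {u, v}" unfolding G31_def using edges_of_doubleton by blast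
    have "u \<in> set (squares n)" "v \<in> set (squares n)" "u \<noteq> v" "same_antidiag u v"
      using e by (auto simp: uv G31_def pair_in_edges_of same_line_sym(4)[of v u])
    thus "e \<in> G3 n"
      using antidiag_meets_lines_once[of u v] same_line_sym[of u v]
      by (auto simp: uv G3_def queens_def G12_def pair_in_edges_of)
  qed
  thus "G3 n = G31 n \<union> G32 n" "G31 n \<inter> G32 n = {}" by (auto simp: G32_def)
qed

text \<open>
  An edge of \<open>G32\<close> is neither antidiagonal nor inside one half, so it joins \<open>V1\<close> to \<open>V2\<close> along a
  row, column or diagonal; diagonals stay within one half. Conversely, a row or column edge
  between the halves is not antidiagonal, and it cannot lie both in a row and in a column.
\<close>

lemma G32_decomposition: "G32 n = G32H n \<union> G32V n" "G32H n \<inter> G32V n = {}"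
proof -
  have cross: "({u, v} \<in> G32 n \<longleftrightarrow> {u, v} \<in> G32H n \<union> G32V n) \<and> {u, v} \<notin> G32H n \<inter> G32V n" for u v
  proof (cases "u \<in> set (squares n) \<and> v \<in> set (squares n) \<and> u \<noteq> v")
    case True
    thus ?thesis
      using antidiag_meets_lines_once[of u v] column_meets_row_once[of u v] same_diag_same_half[of u v]
      by (cases "snd u \<le> fst u"; cases "snd v \<le> fst v"; cases "same_row u v")
        (simp_all add: G32_def G3_def queens_def G12_def G31_def G32H_def G32V_def
          pair_in_edges_of half_iff same_line_sym[of v u], blast+)
  next
    case False
    thus ?thesis
      by (auto simp: G32_def G3_def queens_def G32H_def G32V_def pair_in_edges_of)
  qed
  have pair: "\<exists>u v. e = {u, v}" if "e \<in> G32 n \<union> (G32H n \<union> G32V n)" for e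
    using that edges_of_doubleton unfolding G32_def G3_def queens_def G32H_def G32V_def by blast
  show "G32 n = G32H n \<union> G32V n"
  proof (rule Set.set_eqI)
    fix e show "e \<in> G32 n \<longleftrightarrow> e \<in> G32H n \<union> G32V n" using cross pair[of e] by auto
  qed
  show "G32H n \<inter> G32V n = {}" using cross pair by blast
qed

section \<open>Eigenvalue bounds for the Queens' graph\<close>

theorem theorem4p5:
  fixes n :: nat and i j r s :: "nat \<Rightarrow> nat"
  assumes "n \<ge> 4"
    and "\<And>k. k \<in> {1, 2, 3} \<Longrightarrow>
           i k \<in> {1..n^2} \<and> j k \<in> {1..n^2} \<and> r k \<in> {1..n^2} \<and> s k \<in> {1..n^2}"
    and "\<And>k. k \<in> {1, 2, 3} \<Longrightarrow> i k + j k \<le> n^2 + 1"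
    and "\<And>k. k \<in> {1, 2, 3} \<Longrightarrow> r k + s k \<ge> n^2 + 1"
    and "i 3 + j 3 - 1 = j 2"
    and "i 2 + j 2 - 1 = j 1"
    and "r 3 + s 3 - n^2 = s 2"
    and "r 2 + s 2 - n^2 = s 1"
  shows "eig queens n (i 1 + j 1 - 1) \<le> eig G12 n (i 1) + eig G3 n (j 1)
    \<and> eig G3 n (j 1) = eig G3 n (i 2 + j 2 - 1)
    \<and> eig G3 n (i 2 + j 2 - 1) \<le> eig G31 n (i 2) + eig G32 n (j 2)
    \<and> eig G32 n (j 2) = eig G32 n (i 3 + j 3 - 1)
    \<and> eig G32 n (i 3 + j 3 - 1) \<le> eig G32H n (i 3) + eig G32V n (j 3)
    \<and> eig G12 n (r 1) + eig G3 n (s 1) \<le> eig queens n (r 1 + s 1 - n^2)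
    \<and> eig G31 n (r 2) + eig G32 n (s 2) \<le> eig G3 n (r 2 + s 2 - n^2)
    \<and> eig G3 n (r 2 + s 2 - n^2) = eig G3 n (s 1)
    \<and> eig G32H n (r 3) + eig G32V n (s 3) \<le> eig G32 n (r 3 + s 3 - n^2)
    \<and> eig G32 n (r 3 + s 3 - n^2) = eig G32 n (s 2)"
proof -
  have upper: "graph_eigenvalue (squares n) (E \<union> F) (i k + j k - 1)
      \<le> graph_eigenvalue (squares n) E (i k) + graph_eigenvalue (squares n) F (j k)"
    if "E \<inter> F = {}" "k \<in> {1, 2, 3}" for E F k
    by (rule graph_eigenvalue_Un_le[OF that(1)])
      (use assms(2)[OF that(2)] assms(3)[OF that(2)] in \<open>auto simp: length_squares\<close>)
  have lower: "graph_eigenvalue (squares n) E (r k) + graph_eigenvalue (squares n) F (s k)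
      \<le> graph_eigenvalue (squares n) (E \<union> F) (r k + s k - n\<^sup>2)"
    if "E \<inter> F = {}" "k \<in> {1, 2, 3}" for E F k
    using graph_eigenvalue_Un_ge[OF that(1), of "r k" "s k" "squares n"]
      assms(2)[OF that(2)] assms(4)[OF that(2)] by (auto simp: length_squares)
  note parts = queens_decomposition[of n] G3_decomposition[of n] G32_decomposition[of n]
  show ?thesis
    using upper[OF parts(2), of 1] upper[OF parts(4), of 2] upper[OF parts(6), of 3]
      lower[OF parts(2), of 1] lower[OF parts(4), of 2] lower[OF parts(6), of 3]
    unfolding parts(1,3,5)[symmetric] assms(5-8) by simp
qed

end
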